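(* For $A\subseteq\mathbb{R}^2$, let $\Theta$ be the operator which maps a function $p:A\to\mathbb{R}^2$ with polynomial components to the number of periodic orbits (contained in $A$) of the system $x'=p(x)$. Then $\Theta$ is noncomputable when: (1) $A$ is the (closed) unit ball of $\mathbb{R}^2$; (2) $A=\mathbb{R}^2$. Moreover, in this case there exist a family $\{p_n\}_{n\in\mathbb{N}}$ of functions $p_n:\mathbb{R}^2\to\mathbb{R}^2$ with polynomial components and a value $\delta>0$ such that $\|p_n-p_m\|\ge\delta$ whenever $n\neq m$, with the property that the operator $\Theta$ is still noncomputable over the set $\{p_n:n\in\mathbb{N}\}$ (i.e. the restriction of $\Theta$ to this set is noncomputable).
   Context: A periodic orbit of $x'=p(x)$ in $A$ is a closed curve $\gamma\subseteq A$, not a single equilibrium point, which is the trajectory of a solution and for which there is $T>0$ with $\phi_T(x)=x$ for all $x\in\gamma$, where $\phi_t(x)$ is the solution at time $t$ with initial value $x$ at time $0$. The number of periodic orbits is an element of $\{0,1,2,\dots\}\cup\{\infty\}$. $\|p_n-p_m\|$ denotes $\sup_{x\in\mathbb{R}^2}\|p_n(x)-p_m(x)\|\in[0,\infty]$. Computability is in the sense of computable analysis (type-two theory of effectivity / oracle Turing machines). A function $p$ is given by a name: if $A$ is the closed unit ball, a name of $p$ is a sequence $(P_l)_{l\in\mathbb{N}}$ of functions $\mathbb{R}^2\to\mathbb{R}^2$ with polynomial components with rational coefficients such that $\max_{x\in A}\|p(x)-P_l(x)\|\le 2^{-l}$ and $\max_{x\in A}\|Dp(x)-DP_l(x)\|\le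 2^{-l}$ for all $l$; if $A=\mathbb{R}^2$, the same estimates are required for each $l$ on the closed ball of radius $l$ centered at the origin. The operator $\Theta$ is computable on a set $S$ of such functions if there is an oracle Turing machine which, given any name of any $p\in S$ as an oracle, halts and outputs $\Theta(p)$; otherwise it is noncomputable on $S$. *)

theory Defs
  imports "HOL-Analysis.Analysis" "HOL-Computational_Algebra.Polynomial"
begin

section \<open>Periodic orbits of planar systems\<close>

definition solution_on ::
  "(real^2) set \<Rightarrow> (real^2 \<Rightarrow> real^2) \<Rightarrow> real set \<Rightarrow> (real \<Rightarrow> real^2) \<Rightarrow> bool" where
  "solution_on A p I u \<longleftrightarrow>
     (\<forall>t\<in>I. u t \<in> A \<and> (u has_vector_derivative p (u t)) (at t within I))"

text \<open>\<open>flow_to A p T x y\<close> says that \<open>\<phi>\<^sub>T(x)\<close> is defined and equals \<open>y\<close>. It is used for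
  \<open>T \<ge> 0\<close> only; for a locally Lipschitz \<open>p\<close> it determines \<open>y\<close>.\<close>

definition flow_to ::
  "(real^2) set \<Rightarrow> (real^2 \<Rightarrow> real^2) \<Rightarrow> real \<Rightarrow> real^2 \<Rightarrow> real^2 \<Rightarrow> bool" where
  "flow_to A p T x y \<longleftrightarrow> (\<exists>u. solution_on A p {0..T} u \<and> u 0 = x \<and> u T = y)"

definition closed_curve :: "(real^2) set \<Rightarrow> bool" where
  "closed_curve \<gamma> \<longleftrightarrow> (\<exists>g. path g \<and> pathfinish g = pathstart g \<and> path_image g = \<gamma>)"

text \<open>The trajectory is that of a solution on the whole time axis: a solution through points
  with \<open>\<phi>\<^sub>T(x) = x\<close> always extends to all times, and a solution on a shorter interval could
  trace out only an arc of the orbit.\<close>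

definition periodic_orbit :: "(real^2) set \<Rightarrow> (real^2 \<Rightarrow> real^2) \<Rightarrow> (real^2) set \<Rightarrow> bool" where
  "periodic_orbit A p \<gamma> \<longleftrightarrow>
     \<gamma> \<subseteq> A \<and> closed_curve \<gamma> \<and>
     \<not> (\<exists>x. \<gamma> = {x} \<and> p x = 0) \<and>
     (\<exists>u. solution_on A p UNIV u \<and> \<gamma> = range u) \<and>
     (\<exists>T>0. \<forall>x\<in>\<gamma>. flow_to A p T x x)"

definition num_periodic_orbits :: "(real^2) set \<Rightarrow> (real^2 \<Rightarrow> real^2) \<Rightarrow> enat" where
  "num_periodic_orbits A p =
     (if finite {\<gamma>. periodic_orbit A p \<gamma>} then enat (card {\<gamma>. periodic_orbit A p \<gamma>}) else \<infinity>)"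

definition sup_dist :: "(real^2 \<Rightarrow> real^2) \<Rightarrow> (real^2 \<Rightarrow> real^2) \<Rightarrow> ennreal" where
  "sup_dist f g = (SUP x. ennreal (norm (f x - g x)))"


section \<open>Oracle Turing machines\<close>

text \<open>\<open>Aux i\<close> are additional symbols from which a machine may take finitely many.\<close>

datatype letter =
  Blank | Digit bool | Minus | Slash | Comma | Semicolon | Hash | Infty | Aux nat

datatype move = MoveLeft | MoveRight | Stay

text \<open>A machine has a work tape and an oracle tape, both infinite to the right. In the state
  \<open>query\<close>, the word on the oracle tape is replaced by the oracle's answer and the machine
  passes to the state \<open>answer\<close>. The transition function receives the two scanned symbols and
  returns, for each tape, the symbol to write and the head movement (work tape first).\<close>

record otm =
  num_states :: nat
  alphabet :: "letter set"
  start :: nat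
  halt :: nat
  query :: nat
  answer :: nat
  delta :: "nat \<Rightarrow> letter \<Rightarrow> letter \<Rightarrow> nat \<times> (letter \<times> move) \<times> (letter \<times> move)"

definition oracle_machine :: "otm \<Rightarrow> bool" where
  "oracle_machine M \<longleftrightarrow>
     finite (alphabet M) \<and>
     {Blank, Digit False, Digit True, Minus, Slash, Comma, Semicolon, Hash, Infty} \<subseteq> alphabet M \<and>
     {start M, halt M, query M, answer M} \<subseteq> {..<num_states M} \<and>
     (\<forall>q<num_states M. \<forall>a\<in>alphabet M. \<forall>b\<in>alphabet M.
        delta M q a b \<in> {..<num_states M} \<times> (alphabet M \<times> UNIV) \<times> (alphabet M \<times> UNIV))"

record config =
  state :: nat
  work_tape :: "nat \<Rightarrow> letter"
  work_head :: nat
  oracle_tape :: "nat \<Rightarrow> letter"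
  oracle_head :: nat

definition word_on :: "(nat \<Rightarrow> letter) \<Rightarrow> letter list" where
  "word_on t = map t [0..<(LEAST i. t i = Blank)]"

definition tape_of :: "letter list \<Rightarrow> nat \<Rightarrow> letter" where
  "tape_of w i = (if i < length w then w ! i else Blank)"

fun move_head :: "move \<Rightarrow> nat \<Rightarrow> nat" where
  "move_head MoveLeft i = i - 1"
| "move_head MoveRight i = i + 1"
| "move_head Stay i = i"

text \<open>The index sent to the oracle is written in unary, as the length of the word on the oracle
  tape.\<close>

definition step :: "otm \<Rightarrow> (nat \<Rightarrow> letter list) \<Rightarrow> config \<Rightarrow> config" where
  "step M \<omega> c =
     (if state c = halt M then c
      else if state c = query M then
        c\<lparr>state := answer M,
          oracle_tape := tape_of (\<omega> (length (word_on (oracle_tape c)))),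
          oracle_head := 0\<rparr>
      else
        (case delta M (state c) (work_tape c (work_head c)) (oracle_tape c (oracle_head c)) of
           (q, (a, d), (b, e)) \<Rightarrow>
             \<lparr>state = q,
              work_tape = (work_tape c)(work_head c := a),
              work_head = move_head d (work_head c),
              oracle_tape = (oracle_tape c)(oracle_head c := b),
              oracle_head = move_head e (oracle_head c)\<rparr>))"

definition init_config :: "otm \<Rightarrow> config" where
  "init_config M =
     \<lparr>state = start M, work_tape = tape_of [], work_head = 0,
      oracle_tape = tape_of [], oracle_head = 0\<rparr>"

definition halts_with_output :: "otm \<Rightarrow> (nat \<Rightarrow> letter list) \<Rightarrow> letter list \<Rightarrow> bool" where
  "halts_with_output M \<omega> w \<longleftrightarrow>
     (\<exists>n. state ((step M \<omega> ^^ n) (init_config M)) = halt M \<and>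
          word_on (work_tape ((step M \<omega> ^^ n) (init_config M))) = w)"


lemma halts_with_output_unique:
  assumes "halts_with_output M \<omega> v" "halts_with_output M \<omega> w"
  shows "v = w"
proof -
  let ?c = "\<lambda>n. (step M \<omega> ^^ n) (init_config M)"
  have stop: "step M \<omega> c = c" if "state c = halt M" for c
    using that by (simp add: step_def)
  have fin: "?c (n + k) = ?c n" if "state (?c n) = halt M" for n k
    using that by (induction k) (simp_all add: stop)
  obtain m n where "state (?c m) = halt M" "word_on (work_tape (?c m)) = v"
    "state (?c n) = halt M" "word_on (work_tape (?c n)) = w"
    using assms unfolding halts_with_output_def by blast
  with fin[of m n] fin[of n m] show ?thesis unfolding add.commute[of n m] by metis
qed


section \<open>Rational polynomial maps of the plane and their codes\<close>

text \<open>An element of \<open>rat poly poly\<close> is read as a polynomial in \<open>x $ 1\<close> whose coefficients are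
  polynomials in \<open>x $ 2\<close>; a pair of them gives the two components of a map.\<close>

type_synonym rat_poly_map = "rat poly poly \<times> rat poly poly"

definition eval_poly2 :: "rat poly poly \<Rightarrow> real^2 \<Rightarrow> real" where
  "eval_poly2 P x = poly (map_poly (\<lambda>q. poly (map_poly of_rat q) (x $ 2)) P) (x $ 1)"

definition eval_map :: "rat_poly_map \<Rightarrow> real^2 \<Rightarrow> real^2" where
  "eval_map P x = vector [eval_poly2 (fst P) x, eval_poly2 (snd P) x]"

lemma eval_poly2_eq_sum:
  "eval_poly2 P x =
     (\<Sum>i\<le>degree P. \<Sum>j\<le>degree (coeff P i). of_rat (coeff (coeff P i) j) * (x $ 1) ^ i * (x $ 2) ^ j)"
proof -
  have r: "poly (map_poly of_rat q) y = (\<Sum>j\<le>degree q. of_rat (coeff q j) * y ^ j)"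
    for q and y :: real
    by (simp add: poly_altdef coeff_map_poly degree_map_poly)
  let ?f = "\<lambda>q. poly (map_poly of_rat q) (x $ 2)"
  have f0: "?f 0 = 0" by simp
  have le: "degree (map_poly ?f P) \<le> degree P"
    by (intro degree_le) (simp add: coeff_map_poly coeff_eq_0)
  have "poly (map_poly ?f P) (x $ 1) = (\<Sum>i\<le>degree P. coeff (map_poly ?f P) i * (x $ 1) ^ i)"
    unfolding poly_altdef[of "map_poly ?f P"]
    by (rule sum.mono_neutral_left) (use le in \<open>auto simp: coeff_eq_0\<close>)
  also have "\<dots> = (\<Sum>i\<le>degree P. ?f (coeff P i) * (x $ 1) ^ i)"
    by (simp add: coeff_map_poly)
  finally show ?thesis
    unfolding eval_poly2_def by (simp add: r sum_distrib_right sum_distrib_left mult_ac)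
qed

text \<open>Binary notation, least significant digit first; \<open>0\<close> is the empty word.\<close>

fun code_nat :: "nat \<Rightarrow> letter list" where
  "code_nat n = (if n = 0 then [] else Digit (odd n) # code_nat (n div 2))"

declare code_nat.simps [simp del]

definition code_int :: "int \<Rightarrow> letter list" where
  "code_int z = (if z < 0 then Minus # code_nat (nat (- z)) else code_nat (nat z))"

definition code_rat :: "rat \<Rightarrow> letter list" where
  "code_rat r = code_int (fst (quotient_of r)) @ Slash # code_int (snd (quotient_of r))"

definition code_list :: "letter \<Rightarrow> ('a \<Rightarrow> letter list) \<Rightarrow> 'a list \<Rightarrow> letter list" where
  "code_list s f xs = concat (map (\<lambda>x. f x @ [s]) xs)"

definition code_poly2 :: "rat poly poly \<Rightarrow> letter list" where
  "code_poly2 P = code_list Semicolon (\<lambda>q. code_list Comma code_rat (coeffs q)) (coeffs P)"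

definition code_map :: "rat_poly_map \<Rightarrow> letter list" where
  "code_map P = code_poly2 (fst P) @ Hash # code_poly2 (snd P)"

fun code_enat :: "enat \<Rightarrow> letter list" where
  "code_enat (enat n) = code_nat n"
| "code_enat \<infinity> = [Infty]"


text \<open>The codings lose no information and respect the conventions of the tapes.\<close>

lemma separator_inject:
  "s \<notin> set u \<Longrightarrow> s \<notin> set u' \<Longrightarrow> u @ s # v = u' @ s # v' \<Longrightarrow> u = u' \<and> v = v'"
  by (auto simp: append_eq_append_conv2 append_eq_Cons_conv Cons_eq_append_conv)

lemma code_list_inject:
  assumes inj: "inj f" and s: "\<And>x. s \<notin> set (f x)"
  shows "code_list s f xs = code_list s f ys \<Longrightarrow> xs = ys"
proof (induction xs arbitrary: ys)
  case Nil
  then show ?case by (cases ys) (auto simp: code_list_def)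
next
  case (Cons x xs)
  then obtain y ys' where ys: "ys = y # ys'"
    by (cases ys) (auto simp: code_list_def)
  have e: "f x @ s # code_list s f xs = f y @ s # code_list s f ys'"
    using Cons.prems by (simp add: ys code_list_def)
  have "f x = f y \<and> code_list s f xs = code_list s f ys'"
    using separator_inject[OF s s e] .
  then show ?case using Cons.IH inj ys by (auto dest: injD)
qed

lemma set_code_list: "set (code_list s f xs) \<subseteq> insert s (\<Union>x\<in>set xs. set (f x))"
  by (auto simp: code_list_def)

lemma set_code_nat: "set (code_nat n) \<subseteq> range Digit"
  by (induction n rule: code_nat.induct) (subst code_nat.simps, auto)

lemma inj_code_nat: "inj code_nat"
proof (rule injI)
  show "code_nat m = code_nat n \<Longrightarrow> m = n" for m n
  proof (induction m arbitrary: n rule: code_nat.induct)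
    case (1 m)
    show ?case
    proof (cases "m = 0")
      case True
      then show ?thesis using "1.prems"
        by (subst (asm) code_nat.simps, subst (asm) (2) code_nat.simps) (auto split: if_splits)
    next
      case False
      have "n \<noteq> 0 \<and> odd m = odd n \<and> code_nat (m div 2) = code_nat (n div 2)"
        using "1.prems" False
        by (subst (asm) code_nat.simps, subst (asm) (2) code_nat.simps) (auto split: if_splits)
      then show ?thesis using "1.IH"[OF False, of "n div 2"]
        by (metis bit_eq_rec)
    qed
  qed
qed

lemma set_code_int: "set (code_int z) \<subseteq> insert Minus (range Digit)"
  using set_code_nat[of "nat z"] set_code_nat[of "nat (- z)"] by (auto simp: code_int_def)

lemma inj_code_int: "inj code_int"
proof (rule injI)
  fix y z assume e: "code_int y = code_int z"
  have "Minus \<notin> set (code_nat n)" for n using set_code_nat[of n] by auto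
  then have "code_nat n \<noteq> Minus # w" for n w by (metis list.set_intros(1))
  with e show "y = z"
    by (auto simp: code_int_def inj_eq[OF inj_code_nat] split: if_splits dest: sym)
qed

lemma set_code_rat: "set (code_rat r) \<subseteq> {Minus, Slash} \<union> range Digit"
  using set_code_int[of "fst (quotient_of r)"] set_code_int[of "snd (quotient_of r)"]
  by (auto simp: code_rat_def)

lemma inj_code_rat: "inj code_rat"
proof (rule injI)
  fix q r assume e: "code_rat q = code_rat r"
  have "Slash \<notin> set (code_int n)" for n using set_code_int[of n] by auto
  from this this have "code_int (fst (quotient_of q)) = code_int (fst (quotient_of r)) \<and>
             code_int (snd (quotient_of q)) = code_int (snd (quotient_of r))"
    by (intro separator_inject[OF _ _ e[unfolded code_rat_def]])
  then show "q = r"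
    unfolding inj_eq[OF inj_code_int] by (intro quotient_of_inject prod_eqI) auto
qed

lemma set_code_poly2: "set (code_poly2 P) \<subseteq> {Minus, Slash, Comma, Semicolon} \<union> range Digit"
proof
  fix a assume "a \<in> set (code_poly2 P)"
  then show "a \<in> {Minus, Slash, Comma, Semicolon} \<union> range Digit"
    using subsetD[OF set_code_rat, of a] unfolding code_poly2_def code_list_def by (auto split: if_splits)
qed

lemma inj_code_poly2: "inj code_poly2"
proof (rule injI)
  fix P Q assume e: "code_poly2 P = code_poly2 Q"
  have "inj (\<lambda>q. code_list Comma code_rat (coeffs q))"
  proof (rule injI)
    fix p q assume "code_list Comma code_rat (coeffs p) = code_list Comma code_rat (coeffs q)"
    then have "coeffs p = coeffs q"
      by (rule code_list_inject[OF inj_code_rat, rotated]) (use subsetD[OF set_code_rat] in auto)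
    then show "p = q" by (simp add: coeffs_eq_iff)
  qed
  moreover have "Semicolon \<notin> set (code_list Comma code_rat (coeffs q))" for q
    using subsetD[OF set_code_rat, of Semicolon] unfolding code_list_def by auto
  ultimately have "coeffs P = coeffs Q"
    using e unfolding code_poly2_def by (rule code_list_inject)
  then show "P = Q" by (simp add: coeffs_eq_iff)
qed

lemma inj_code_map: "inj code_map"
proof (rule injI)
  fix P Q assume e: "code_map P = code_map Q"
  have "Hash \<notin> set (code_poly2 R)" for R using set_code_poly2[of R] by auto
  from this this have "code_poly2 (fst P) = code_poly2 (fst Q) \<and> code_poly2 (snd P) = code_poly2 (snd Q)"
    by (intro separator_inject[OF _ _ e[unfolded code_map_def]])
  then show "P = Q" by (simp add: inj_eq[OF inj_code_poly2] prod_eq_iff)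
qed

lemma Blank_notin_code_map: "Blank \<notin> set (code_map P)"
  using set_code_poly2[of "fst P"] set_code_poly2[of "snd P"] by (auto simp: code_map_def)

lemma Blank_notin_code_enat: "Blank \<notin> set (code_enat x)"
  using set_code_nat[of "the_enat x"] by (cases x) auto

lemma inj_code_enat: "inj code_enat"
proof (rule injI)
  have "Infty \<notin> set (code_nat n)" for n using set_code_nat[of n] by auto
  then have ne: "code_nat n \<noteq> [Infty]" for n by (metis list.set_intros(1))
  show "x = y" if "code_enat x = code_enat y" for x y
    using that by (cases x; cases y) (simp_all add: inj_eq[OF inj_code_nat] ne not_sym[OF ne])
qed


section \<open>Names and computability\<close>

text \<open>\<open>K l\<close> is the compact set on which the \<open>l\<close>-th estimate is required: constantly the unit
  ball for maps on the unit ball, and the ball of radius \<open>l\<close> for maps on the plane.\<close>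

definition is_name ::
  "(nat \<Rightarrow> (real^2) set) \<Rightarrow> (real^2 \<Rightarrow> real^2) \<Rightarrow> (nat \<Rightarrow> rat_poly_map) \<Rightarrow> bool" where
  "is_name K p P \<longleftrightarrow>
     (\<forall>l. \<forall>x\<in>K l.
        norm (p x - eval_map (P l) x) \<le> 1 / 2 ^ l \<and>
        onorm (\<lambda>h. frechet_derivative p (at x) h - frechet_derivative (eval_map (P l)) (at x) h)
          \<le> 1 / 2 ^ l)"

definition computable_on ::
  "(nat \<Rightarrow> (real^2) set) \<Rightarrow> ((real^2 \<Rightarrow> real^2) \<Rightarrow> enat) \<Rightarrow> (real^2 \<Rightarrow> real^2) set \<Rightarrow> bool" where
  "computable_on K \<Theta> S \<longleftrightarrow>
     (\<exists>M. oracle_machine M \<and>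
        (\<forall>p\<in>S. \<forall>P. is_name K p P \<longrightarrow>
           halts_with_output M (\<lambda>l. code_map (P l)) (code_enat (\<Theta> p))))"

text \<open>A map on the unit ball with polynomial components is represented by its unique polynomial
  extension to the plane. The notions above then involve it only through its values and
  derivatives on the ball.\<close>

abbreviation polynomial_maps :: "(real^2 \<Rightarrow> real^2) set" where
  "polynomial_maps \<equiv> {p. polynomial_function p}"

end

theory Submission
  imports Defs
begin

text \<open>The number of periodic orbits is already discontinuous along a family of linear systems.
  The rotation \<open>x' = - y, y' = x\<close> has every circle about the origin as a periodic orbit, inside
  the unit ball as well as in the plane. For \<open>\<epsilon> \<noteq> 0\<close> the system
  \<open>x' = \<epsilon> x - y, y' = x + \<epsilon> y\<close> has none: the squared norm of a solution is multiplied by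
  \<open>exp (2 \<epsilon> T)\<close> in time \<open>T\<close>, so only the equilibrium can return to its starting point.

  A machine that halts has read finitely many entries of the name given to it
  (\<open>halts_with_output_use\<close>). When it is run on the constant name of the rotation and answers
  \<open>\<infinity>\<close>, the entries that it has read are therefore also the first entries of a name of the system
  with a sufficiently small \<open>\<epsilon> \<noteq> 0\<close>, on which it gives the same, now wrong, answer.

  The parameters \<open>\<epsilon> = 0\<close> and \<open>\<epsilon> = 1 / n\<close> suffice for this argument, which yields the uniformly
  separated family: two distinct systems differ by a nonzero multiple of the identity, which is
  unbounded on the plane although it is arbitrarily small on every fixed ball.\<close>

section \<open>Finite use of the oracle\<close>

lemma run_use:
  "\<exists>L. \<forall>\<omega>'. (\<forall>l\<le>L. \<omega>' l = \<omega> l) \<longrightarrow> (step M \<omega>' ^^ n) c = (step M \<omega> ^^ n) c"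
proof (induction n)
  case 0
  then show ?case by simp
next
  case (Suc n)
  then obtain L where
    L: "\<And>\<omega>'. (\<forall>l\<le>L. \<omega>' l = \<omega> l) \<Longrightarrow> (step M \<omega>' ^^ n) c = (step M \<omega> ^^ n) c"
    by blast
  let ?c = "(step M \<omega> ^^ n) c"
  let ?k = "length (word_on (oracle_tape ?c))"
  have same_step: "step M \<omega>' ?c = step M \<omega> ?c" if "\<omega>' ?k = \<omega> ?k" for \<omega>'
    using that by (simp add: step_def)
  show ?case
  proof (intro exI allI impI)
    fix \<omega>' assume "\<forall>l\<le>max L ?k. \<omega>' l = \<omega> l"
    then have "(step M \<omega>' ^^ n) c = ?c" "\<omega>' ?k = \<omega> ?k"
      by (auto intro: L)
    then show "(step M \<omega>' ^^ Suc n) c = (step M \<omega> ^^ Suc n) c"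
      by (simp add: same_step[of \<omega>'])
  qed
qed

lemma halts_with_output_use:
  assumes "halts_with_output M \<omega> w"
  obtains L where "\<And>\<omega>'. (\<And>l. l \<le> L \<Longrightarrow> \<omega>' l = \<omega> l) \<Longrightarrow> halts_with_output M \<omega>' w"
proof -
  obtain n where n: "state ((step M \<omega> ^^ n) (init_config M)) = halt M"
    "word_on (work_tape ((step M \<omega> ^^ n) (init_config M))) = w"
    using assms unfolding halts_with_output_def by blast
  obtain L where L: "\<And>\<omega>'. (\<forall>l\<le>L. \<omega>' l = \<omega> l) \<Longrightarrow>
      (step M \<omega>' ^^ n) (init_config M) = (step M \<omega> ^^ n) (init_config M)"
    using run_use[where \<omega> = \<omega> and M = M and n = n and c = "init_config M"] by blast
  show ?thesis
  proof (rule that[of L])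
    fix \<omega>' assume "\<And>l. l \<le> L \<Longrightarrow> \<omega>' l = \<omega> l"
    then have "(step M \<omega>' ^^ n) (init_config M) = (step M \<omega> ^^ n) (init_config M)"
      by (intro L) simp
    with n show "halts_with_output M \<omega>' w"
      unfolding halts_with_output_def by (intro exI[of _ n]) simp
  qed
qed

text \<open>Computable operators are continuous: a point of discontinuity, witnessed by names with
  arbitrarily long common beginnings, rules out computability.\<close>

lemma not_computable_onI:
  assumes "p \<in> S" "is_name K p P"
    and jump: "\<And>L. \<exists>q\<in>S. \<exists>Q. is_name K q Q \<and> (\<forall>l\<le>L. Q l = P l) \<and> \<Theta> q \<noteq> \<Theta> p"
  shows "\<not> computable_on K \<Theta> S"
proof
  assume "computable_on K \<Theta> S"
  then obtain M where M: "\<And>p P. p \<in> S \<Longrightarrow> is_name K p P \<Longrightarrow>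
      halts_with_output M (\<lambda>l. code_map (P l)) (code_enat (\<Theta> p))"
    unfolding computable_on_def by blast
  obtain L where L: "\<And>\<omega>'. (\<And>l. l \<le> L \<Longrightarrow> \<omega>' l = code_map (P l)) \<Longrightarrow>
      halts_with_output M \<omega>' (code_enat (\<Theta> p))"
    using halts_with_output_use[OF M[OF assms(1,2)]] by blast
  obtain q Q where q: "q \<in> S" "is_name K q Q" "\<forall>l\<le>L. Q l = P l" "\<Theta> q \<noteq> \<Theta> p"
    using jump[of L] by blast
  have "halts_with_output M (\<lambda>l. code_map (Q l)) (code_enat (\<Theta> p))"
    by (rule L) (use q(3) in simp)
  with M[OF q(1,2)] have "code_enat (\<Theta> q) = code_enat (\<Theta> p)"
    by (rule halts_with_output_unique)
  with q(4) show False
    by (simp add: inj_eq[OF inj_code_enat])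
qed

lemma computable_on_subset:
  "computable_on K \<Theta> S \<Longrightarrow> S' \<subseteq> S \<Longrightarrow> computable_on K \<Theta> S'"
  unfolding computable_on_def by blast

section \<open>Linear spirals and their names\<close>

definition spiral :: "real \<Rightarrow> real^2 \<Rightarrow> real^2" where
  "spiral \<epsilon> x = vector [\<epsilon> * x $ 1 - x $ 2, x $ 1 + \<epsilon> * x $ 2]"

definition spiral_poly :: "rat \<Rightarrow> rat_poly_map" where
  "spiral_poly e = ([:[:0, -1:], [:e:]:], [:[:0, e:], [:1:]:])"

lemma spiral_nth [simp]:
  "spiral \<epsilon> x $ 1 = \<epsilon> * x $ 1 - x $ 2" "spiral \<epsilon> x $ 2 = x $ 1 + \<epsilon> * x $ 2"
  by (simp_all add: spiral_def)

lemma spiral_diff: "spiral \<epsilon> x - spiral \<eta> x = (\<epsilon> - \<eta>) *\<^sub>R x"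
  by (simp add: vec_eq_iff forall_2 algebra_simps)

lemma eval_map_spiral_poly: "eval_map (spiral_poly e) = spiral (of_rat e)"
  by (rule ext) (simp add: eval_map_def spiral_poly_def eval_poly2_def spiral_def map_poly_pCons mult.commute add.commute)

lemma bounded_linear_spiral: "bounded_linear (spiral \<epsilon>)"
  by (intro linear_conv_bounded_linear[THEN iffD1] linearI)
    (simp_all add: vec_eq_iff forall_2 algebra_simps)

lemma frechet_derivative_spiral: "frechet_derivative (spiral \<epsilon>) (at x) = spiral \<epsilon>"
  using frechet_derivative_at[OF bounded_linear_imp_has_derivative[OF bounded_linear_spiral]]
  by simp

lemma polynomial_function_spiral: "polynomial_function (spiral \<epsilon>)"
  by (rule polynomial_function_bounded_linear[OF bounded_linear_spiral])

text \<open>The difference of two spirals is a multiple of the identity, so the estimates on values and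
  on derivatives only concern the parameters.\<close>

lemma is_name_spiral:
  assumes "\<And>l x. x \<in> K l \<Longrightarrow> \<bar>\<epsilon> - of_rat (e l)\<bar> * norm x \<le> 1 / 2 ^ l"
    and "\<And>l. \<bar>\<epsilon> - of_rat (e l)\<bar> \<le> 1 / 2 ^ l"
  shows "is_name K (spiral \<epsilon>) (\<lambda>l. spiral_poly (e l))"
proof -
  have "onorm (\<lambda>h::real^2. c *\<^sub>R h) = \<bar>c\<bar>" for c
    using onorm_scaleR[of "\<lambda>h::real^2. h" c] by (simp add: onorm_id)
  then show ?thesis
    using assms
    by (simp add: is_name_def eval_map_spiral_poly frechet_derivative_spiral spiral_diff)
qed

lemma sup_dist_spiral:
  assumes "\<epsilon> \<noteq> \<eta>"
  shows "sup_dist (spiral \<epsilon>) (spiral \<eta>) \<ge> 1"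
proof -
  let ?x = "axis 1 (1 / (\<epsilon> - \<eta>)) :: real^2"
  have "spiral \<epsilon> ?x - spiral \<eta> ?x = axis 1 1"
    using assms unfolding spiral_diff by (simp add: vec_eq_iff axis_def)
  then have "norm (spiral \<epsilon> ?x - spiral \<eta> ?x) = 1" by simp
  then show ?thesis
    unfolding sup_dist_def by (intro SUP_upper2[of ?x]) simp_all
qed

section \<open>Periodic orbits of linear spirals\<close>

text \<open>The squared norm \<open>N\<close> of a solution satisfies \<open>N' = 2 \<epsilon> N\<close>, because the rotational part of
  the field is orthogonal to the position vector.\<close>

lemma norm_spiral_solution:
  assumes u: "solution_on A (spiral \<epsilon>) {0..T} u" and T: "0 \<le> T"
  shows "(norm (u T))\<^sup>2 = exp (2 * \<epsilon> * T) * (norm (u 0))\<^sup>2"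
proof -
  (* Dividing by the expected growth turns the claim into constancy. *)
  define f where "f t = exp (- 2 * \<epsilon> * t) * (u t \<bullet> u t)" for t
  have "(f has_vector_derivative 0) (at t within {0..T})" if t: "t \<in> {0..T}" for t
  proof -
    have du: "(u has_derivative (\<lambda>h. h *\<^sub>R spiral \<epsilon> (u t))) (at t within {0..T})"
      using u t unfolding solution_on_def has_vector_derivative_def by blast
    have orth: "u t \<bullet> spiral \<epsilon> (u t) = \<epsilon> * (u t \<bullet> u t)"
      by (simp add: inner_vec_def sum_2 algebra_simps)
    have "((\<lambda>t. u t \<bullet> u t) has_real_derivative 2 * \<epsilon> * (u t \<bullet> u t)) (at t within {0..T})"
      unfolding has_field_derivative_def
      by (rule has_derivative_eq_rhs[OF has_derivative_inner[OF du du]])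
        (simp add: fun_eq_iff inner_commute[of "spiral \<epsilon> (u t)"] orth)
    moreover have "((\<lambda>t. exp (- 2 * \<epsilon> * t)) has_real_derivative - 2 * \<epsilon> * exp (- 2 * \<epsilon> * t))
        (at t within {0..T})"
      by (auto intro!: derivative_eq_intros)
    ultimately have "(f has_real_derivative - 2 * \<epsilon> * exp (- 2 * \<epsilon> * t) * (u t \<bullet> u t) +
        2 * \<epsilon> * (u t \<bullet> u t) * exp (- 2 * \<epsilon> * t)) (at t within {0..T})"
      unfolding f_def by (intro DERIV_mult)
    then show ?thesis by (simp add: has_real_derivative_iff_has_vector_derivative)
  qed
  then have "f T = f 0"
    using has_vector_derivative_zero_constant[of "{0..T}" f] T
    by (metis atLeastAtMost_iff convex_real_interval(5) order_refl)
  then show ?thesis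
    by (simp add: f_def power2_norm_eq_inner exp_minus field_simps)
qed

lemma no_periodic_orbit_spiral:
  assumes "\<epsilon> \<noteq> 0"
  shows "\<not> periodic_orbit A (spiral \<epsilon>) \<gamma>"
proof
  assume per: "periodic_orbit A (spiral \<epsilon>) \<gamma>"
  then obtain T where T: "T > 0" "\<forall>x\<in>\<gamma>. flow_to A (spiral \<epsilon>) T x x"
    unfolding periodic_orbit_def by blast
  have "x = 0" if x: "x \<in> \<gamma>" for x
  proof -
    obtain u where "solution_on A (spiral \<epsilon>) {0..T} u" "u 0 = x" "u T = x"
      using T(2) x unfolding flow_to_def by blast
    with norm_spiral_solution[of A \<epsilon> T u] T(1)
    have "(norm x)\<^sup>2 = exp (2 * \<epsilon> * T) * (norm x)\<^sup>2" by simp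
    moreover have "exp (2 * \<epsilon> * T) \<noteq> 1" using assms T(1) by simp
    ultimately show ?thesis by simp
  qed
  moreover have "\<gamma> \<noteq> {}"
    using per unfolding periodic_orbit_def by blast
  ultimately have "\<gamma> = {0}" by blast
  moreover have "spiral \<epsilon> 0 = 0"
    by (simp add: vec_eq_iff forall_2)
  ultimately show False
    using per unfolding periodic_orbit_def by blast
qed

lemma num_periodic_orbits_spiral:
  assumes "\<epsilon> \<noteq> 0"
  shows "num_periodic_orbits A (spiral \<epsilon>) = 0"
proof -
  have none: "{\<gamma>. periodic_orbit A (spiral \<epsilon>) \<gamma>} = {}"
    using no_periodic_orbit_spiral[OF assms] by blast
  show ?thesis
    unfolding num_periodic_orbits_def none by (simp add: zero_enat_def)
qed

definition circ :: "real \<Rightarrow> real \<Rightarrow> real^2" where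
  "circ r t = vector [r * cos t, r * sin t]"

lemma circ_nth [simp]: "circ r t $ 1 = r * cos t" "circ r t $ 2 = r * sin t"
  by (simp_all add: circ_def)

lemma norm_circ: "0 \<le> r \<Longrightarrow> norm (circ r t) = r"
proof -
  have "(r * cos t)\<^sup>2 + (r * sin t)\<^sup>2 = r\<^sup>2 * ((cos t)\<^sup>2 + (sin t)\<^sup>2)"
    by (simp only: power_mult_distrib distrib_left)
  then show "0 \<le> r \<Longrightarrow> norm (circ r t) = r"
    by (simp add: norm_vec_def L2_set_def sum_2)
qed

lemma circ_has_vector_derivative:
  "((\<lambda>t. circ r (s + t)) has_vector_derivative spiral 0 (circ r (s + t))) (at t within I)"
proof -
  have "((\<lambda>t. circ r (s + t) $ i) has_vector_derivative spiral 0 (circ r (s + t)) $ i)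
      (at t within I)" for i
    using exhaust_2[of i]
    by (auto simp: has_real_derivative_iff_has_vector_derivative[symmetric]
        intro!: derivative_eq_intros)
  then show ?thesis
    unfolding has_vector_derivative_def
    by (subst has_derivative_componentwise_within)
      (auto simp: Basis_vec_def inner_axis)
qed

lemma circ_surj:
  assumes "0 < r" "norm x = r"
  obtains s where "0 \<le> s" "s \<le> 2 * pi" "x = circ r s"
proof -
  have "(x $ 1)\<^sup>2 + (x $ 2)\<^sup>2 = r\<^sup>2"
    unfolding assms(2)[symmetric] by (simp add: norm_vec_def L2_set_def sum_2)
  then have "(x $ 1 / r)\<^sup>2 + (x $ 2 / r)\<^sup>2 = 1"
    using assms(1) by (simp add: power_divide add_divide_distrib[symmetric])
  then obtain s where "0 \<le> s" "s \<le> 2 * pi" "x $ 1 / r = cos s" "x $ 2 / r = sin s"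
    using sincos_total_2pi_le by blast
  with assms(1) show ?thesis
    by (intro that[of s]) (auto simp: vec_eq_iff forall_2 field_simps)
qed

lemma periodic_orbit_sphere:
  assumes r: "0 < r" and A: "sphere 0 r \<subseteq> A"
  shows "periodic_orbit A (spiral 0) (sphere 0 r)"
proof -
  have range: "circ r t \<in> sphere 0 r" for t
    using r by (simp add: norm_circ)
  have sol: "solution_on A (spiral 0) I (\<lambda>t. circ r (s + t))" for I s
    using range A circ_has_vector_derivative unfolding solution_on_def by blast
  have flow: "flow_to A (spiral 0) (2 * pi) x x" if x: "x \<in> sphere 0 r" for x
  proof -
    obtain s where s: "x = circ r s" using circ_surj[OF r, of x] x by auto
    have "circ r (s + 2 * pi) = circ r s"
      by (simp add: vec_eq_iff forall_2)
    then show ?thesis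
      unfolding flow_to_def using sol[of "{0..2 * pi}" s] s
      by (intro exI[of _ "\<lambda>t. circ r (s + t)"]) simp
  qed
  have closed: "closed_curve (sphere (0 :: real^2) r)"
    unfolding closed_curve_def
  proof (intro exI conjI)
    let ?g = "\<lambda>t. circ r (2 * pi * t)"
    have "continuous_on UNIV (circ r)"
      using circ_has_vector_derivative[of r 0]
      by (auto simp: continuous_on_eq_continuous_within intro: has_vector_derivative_continuous)
    then show "path ?g"
      unfolding path_def by (rule continuous_on_compose2) (auto intro!: continuous_intros)
    show "pathfinish ?g = pathstart ?g"
      by (simp add: pathfinish_def pathstart_def vec_eq_iff forall_2)
    show "path_image ?g = sphere 0 r"
    proof
      show "path_image ?g \<subseteq> sphere 0 r"
        using range by (auto simp: path_image_def)
      show "sphere 0 r \<subseteq> path_image ?g"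
      proof
        fix x :: "real^2" assume "x \<in> sphere 0 r"
        then obtain s where "0 \<le> s" "s \<le> 2 * pi" "x = circ r s"
          using circ_surj[OF r, of x] by auto
        then show "x \<in> path_image ?g"
          unfolding path_image_def by (intro image_eqI[of _ _ "s / (2 * pi)"]) auto
      qed
    qed
  qed
  have "sphere 0 r \<noteq> {x :: real^2}" for x
  proof
    assume "sphere 0 r = {x}"
    with range[of 0] range[of pi] have "circ r 0 = circ r pi" by auto
    then have "circ r 0 $ 1 = circ r pi $ 1" by simp
    with r show False by simp
  qed
  moreover have "sphere 0 r = range (circ r)"
  proof
    show "sphere 0 r \<subseteq> range (circ r)"
    proof
      fix x :: "real^2" assume "x \<in> sphere 0 r"
      then obtain s where "x = circ r s" using circ_surj[OF r, of x] by auto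
      then show "x \<in> range (circ r)" by blast
    qed
  qed (use range in blast)
  then have "\<exists>u. solution_on A (spiral 0) UNIV u \<and> sphere 0 r = range u"
    using sol[of UNIV 0] by (intro exI[of _ "circ r"]) simp
  moreover have "\<exists>T>0. \<forall>x\<in>sphere 0 r. flow_to A (spiral 0) T x x"
    using flow by (intro exI[of _ "2 * pi"]) simp
  ultimately show ?thesis
    unfolding periodic_orbit_def using A closed by blast
qed

lemma num_periodic_orbits_rotation:
  assumes "cball 0 1 \<subseteq> A"
  shows "num_periodic_orbits A (spiral 0) = \<infinity>"
proof -
  have "inj_on (sphere (0 :: real^2)) {0<..1}"
  proof (rule inj_onI)
    fix r s :: real assume r: "r \<in> {0<..1}" and eq: "sphere (0 :: real^2) r = sphere 0 s"
    from r have "norm (circ r 0) = r" by (simp add: norm_circ)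
    moreover from this have "circ r 0 \<in> sphere 0 s" unfolding eq[symmetric] by simp
    ultimately show "r = s" by simp
  qed
  moreover have "infinite {0<..1::real}" by simp
  ultimately have "infinite (sphere (0 :: real^2) ` {0<..1})"
    by (simp add: finite_image_iff)
  moreover have "sphere 0 ` {0<..1} \<subseteq> {\<gamma>. periodic_orbit A (spiral 0) \<gamma>}"
    using assms by (auto intro!: periodic_orbit_sphere)
  ultimately have "infinite {\<gamma>. periodic_orbit A (spiral 0) \<gamma>}"
    using finite_subset by blast
  then show ?thesis
    by (simp add: num_periodic_orbits_def)
qed

section \<open>Noncomputability\<close>

text \<open>Division by zero gives \<open>0\<close>, so the member with index \<open>0\<close> is the rotation, to which the
  others converge uniformly on every ball.\<close>

definition spiral_family :: "nat \<Rightarrow> real^2 \<Rightarrow> real^2" where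
  "spiral_family n = spiral (1 / real n)"

lemma not_computable_on_spiral_family:
  assumes A: "cball 0 1 \<subseteq> A" and K: "\<And>l. K l \<subseteq> cball 0 (real l + 1)"
  shows "\<not> computable_on K (num_periodic_orbits A) (range spiral_family)"
proof (rule not_computable_onI)
  show "spiral_family 0 \<in> range spiral_family" by blast
  show "is_name K (spiral_family 0) (\<lambda>l. spiral_poly 0)"
    unfolding spiral_family_def by (rule is_name_spiral) simp_all
next
  fix L :: nat
  (* The entries up to L only require K l, so a ball of radius L + 1, and accuracy 1 / 2 ^ L;
     this choice of n makes the difference (1 / n) x to the rotation small enough there. *)
  define n where "n = (L + 1) * 2 ^ L"
  define e where "e l = (if l \<le> L then 0 else 1 / of_nat n :: rat)" for l
  have n: "real n = (real L + 1) * 2 ^ L" "n > 0" by (simp_all add: n_def algebra_simps)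
  have close: "\<bar>1 / real n - of_rat (e l)\<bar> * r \<le> 1 / 2 ^ l"
    if "0 \<le> r" "r \<le> real l + 1" for l r
  proof (cases "l \<le> L")
    case True
    have "\<bar>1 / real n - of_rat (e l)\<bar> * r = r / real n"
      using True by (simp add: e_def)
    also have "\<dots> \<le> (real L + 1) / real n"
      using that True by (intro divide_right_mono) auto
    also have "\<dots> = 1 / 2 ^ L"
      unfolding n(1) by simp
    also have "\<dots> \<le> 1 / 2 ^ l"
      using True by (intro divide_left_mono power_increasing) auto
    finally show ?thesis .
  next
    case False
    then show ?thesis by (simp add: e_def of_rat_divide)
  qed
  have "is_name K (spiral_family n) (\<lambda>l. spiral_poly (e l))"
    unfolding spiral_family_def
  proof (rule is_name_spiral)
    show "\<bar>1 / real n - of_rat (e l)\<bar> * norm x \<le> 1 / 2 ^ l" if "x \<in> K l" for l x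
      using close[of "norm x" l] K[of l] that by auto
    show "\<bar>1 / real n - of_rat (e l)\<bar> \<le> 1 / 2 ^ l" for l
      using close[of 1 l] by simp
  qed
  moreover have "num_periodic_orbits A (spiral_family n) \<noteq> num_periodic_orbits A (spiral_family 0)"
    using n(2) A
    by (simp add: spiral_family_def num_periodic_orbits_spiral num_periodic_orbits_rotation)
  ultimately show "\<exists>q\<in>range spiral_family. \<exists>Q. is_name K q Q \<and>
      (\<forall>l\<le>L. Q l = spiral_poly 0) \<and>
      num_periodic_orbits A q \<noteq> num_periodic_orbits A (spiral_family 0)"
    by (intro bexI[of _ "spiral_family n"] exI[of _ "\<lambda>l. spiral_poly (e l)"])
      (auto simp: e_def)
qed

theorem theoremA:
  shows "\<not> computable_on (\<lambda>l. cball 0 1) (num_periodic_orbits (cball 0 1)) polynomial_maps \<and>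
    \<not> computable_on (\<lambda>l. cball 0 (real l)) (num_periodic_orbits UNIV) polynomial_maps \<and>
    (\<exists>(p :: nat \<Rightarrow> real^2 \<Rightarrow> real^2) (\<delta> :: real).
       (\<forall>n. polynomial_function (p n)) \<and> \<delta> > 0 \<and>
       (\<forall>n m. n \<noteq> m \<longrightarrow> sup_dist (p n) (p m) \<ge> ennreal \<delta>) \<and>
       \<not> computable_on (\<lambda>l. cball 0 (real l)) (num_periodic_orbits UNIV) (range p))"
proof -
  have poly: "polynomial_function (spiral_family n)" for n
    by (simp add: spiral_family_def polynomial_function_spiral)
  have ball: "\<not> computable_on (\<lambda>l. cball 0 1) (num_periodic_orbits (cball 0 1)) (range spiral_family)"
    by (rule not_computable_on_spiral_family) auto
  have plane: "\<not> computable_on (\<lambda>l. cball 0 (real l)) (num_periodic_orbits UNIV) (range spiral_family)"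
    by (rule not_computable_on_spiral_family) auto
  have sep: "sup_dist (spiral_family n) (spiral_family m) \<ge> ennreal 1" if "n \<noteq> m" for n m
    using that sup_dist_spiral[of "1 / real n" "1 / real m"] by (simp add: spiral_family_def)
  have sub: "range spiral_family \<subseteq> polynomial_maps"
    using poly by blast
  show ?thesis
  proof (intro conjI)
    show "\<not> computable_on (\<lambda>l. cball 0 1) (num_periodic_orbits (cball 0 1)) polynomial_maps"
      using ball computable_on_subset[OF _ sub] by blast
    show "\<not> computable_on (\<lambda>l. cball 0 (real l)) (num_periodic_orbits UNIV) polynomial_maps"
      using plane computable_on_subset[OF _ sub] by blast
    show "\<exists>(p :: nat \<Rightarrow> real^2 \<Rightarrow> real^2) (\<delta> :: real).
       (\<forall>n. polynomial_function (p n)) \<and> \<delta> > 0 \<and>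
       (\<forall>n m. n \<noteq> m \<longrightarrow> sup_dist (p n) (p m) \<ge> ennreal \<delta>) \<and>
       \<not> computable_on (\<lambda>l. cball 0 (real l)) (num_periodic_orbits UNIV) (range p)"
      using poly sep plane by (intro exI[of _ spiral_family] exI[of _ "1 :: real"]) auto
  qed
qed

end
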